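(* Let $d\ge 1$ and let $\mathcal K$ be the set of convex bodies in $\mathbb R^d$ containing $0$ in their interior. For $m\in\mathbb N$, $m\geq 1$, $\beta>0$ and $W\in\mathbb R^{d\times m}$, write $\theta=(\beta,W)$ and let $p_\theta:\mathbb R^d\to\mathbb R$ be the sublinear network with parameters $\theta$. For each $\theta$ such that $p_\theta>0$ on $\mathbb R^d\setminus\{0\}$, let $\Omega_\theta:=\phi_\theta(B)$, where $B$ is the closed unit ball and $\phi_\theta$ is one of the following two maps (the same choice being made for all $\theta$), extended by $\phi_\theta(0)=0$: (gauge parametrization) $\phi_\theta(x)=\frac{\|x\|}{p_\theta(x)}\,x$, (support parametrization) $\phi_\theta(x)=\|x\|\,\nabla p_\theta(x)$. Let $\mathcal K^{\mathrm{NN}}$ be the set of all $\Omega_\theta$ obtained in this way as $m\geq 1$, $\beta>0$ and $W\in\mathbb R^{d\times m}$ vary. Then, for either of the two choices of parametrization, $\mathcal K^{\mathrm{NN}}$ is dense in $\mathcal K$ with respect to the Hausdorff distance.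
   Context: A convex body in $\mathbb R^d$ is a compact convex set with non-empty interior. $\|\cdot\|$ is the Euclidean norm and $B=\{x\in\mathbb R^d:\|x\|\le 1\}$. The sublinear network with parameters $\theta=(\beta,W)$, $\beta>0$, $W\in\mathbb R^{d\times m}$, is $$p_\theta(x):=\beta\,\|x\|\,\mathrm{LSE}\!\left(W^T\frac{x}{\|x\|}\right)\quad (x\neq 0),\qquad p_\theta(0):=0,$$ where $\mathrm{LSE}(y_1,\dots,y_m)=\log\left(\sum_{i=1}^m e^{y_i}\right)$. It is $C^\infty$ on $\mathbb R^d\setminus\{0\}$, so $\nabla p_\theta$ is defined there. The Hausdorff distance between $K,L\in\mathcal K$ is $d_H(K,L)=\max\{\sup_{x\in K}d(x,L),\ \sup_{x\in L}d(x,K)\}$, where $d(x,L)=\inf_{y\in L}\|x-y\|$. *)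

theory Defs
  imports "HOL-Analysis.Analysis"
begin

section \<open>Convex bodies and the Hausdorff distance\<close>

definition convex_body :: "(real ^ 'n) set \<Rightarrow> bool" where
  "convex_body K \<longleftrightarrow> compact K \<and> convex K \<and> interior K \<noteq> {}"

definition convex_bodies0 :: "(real ^ 'n) set set" where
  "convex_bodies0 = {K. convex_body K \<and> 0 \<in> interior K}"

text \<open>The real-valued suprema are meaningful only for nonempty bounded sets, in particular for
  convex bodies.\<close>

definition hausdorff_dist :: "(real ^ 'n) set \<Rightarrow> (real ^ 'n) set \<Rightarrow> real" where
  "hausdorff_dist K L = max (SUP x\<in>K. infdist x L) (SUP x\<in>L. infdist x K)"

section \<open>Sublinear networks\<close>

definition LSE :: "nat \<Rightarrow> (nat \<Rightarrow> real) \<Rightarrow> real" where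
  "LSE m y = ln (\<Sum>i<m. exp (y i))"

text \<open>As \<open>m\<close> varies, a \<open>d \<times> m\<close> matrix \<open>W\<close> is given by its columns \<open>W 0, \<dots>, W (m - 1)\<close>, so that
  the \<open>i\<close>-th entry of \<open>W\<^sup>T u\<close> is \<open>W i \<bullet> u\<close>. The values of \<open>W\<close> at indices \<open>\<ge> m\<close> are irrelevant.\<close>

definition sublinear_net :: "nat \<Rightarrow> real \<Rightarrow> (nat \<Rightarrow> real ^ 'n) \<Rightarrow> real ^ 'n \<Rightarrow> real" where
  "sublinear_net m \<beta> W x =
     (if x = 0 then 0 else \<beta> * norm x * LSE m (\<lambda>i. W i \<bullet> (x /\<^sub>R norm x)))"

section \<open>Gauge and support parametrizations\<close>

definition gradient :: "('a::real_inner \<Rightarrow> real) \<Rightarrow> 'a \<Rightarrow> 'a" where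
  "gradient f x = (THE D. GDERIV f x :> D)"

lemma gradient_eqI:
  assumes "GDERIV f x :> D"
  shows "gradient f x = D"
  unfolding gradient_def
proof (rule the_equality)
  show "GDERIV f x :> D" by (fact assms)
next
  fix E assume "GDERIV f x :> E"
  then have "(\<lambda>h. h \<bullet> E) = (\<lambda>h. h \<bullet> D)"
    using assms has_derivative_unique unfolding gderiv_def by blast
  then show "E = D"
    by (metis vector_eq_ldot)
qed

definition gauge_param :: "(real ^ 'n \<Rightarrow> real) \<Rightarrow> real ^ 'n \<Rightarrow> real ^ 'n" where
  "gauge_param p x = (if x = 0 then 0 else (norm x / p x) *\<^sub>R x)"

definition support_param :: "(real ^ 'n \<Rightarrow> real) \<Rightarrow> real ^ 'n \<Rightarrow> real ^ 'n" where
  "support_param p x = (if x = 0 then 0 else norm x *\<^sub>R gradient p x)"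

definition NN_bodies ::
  "((real ^ 'n \<Rightarrow> real) \<Rightarrow> real ^ 'n \<Rightarrow> real ^ 'n) \<Rightarrow> (real ^ 'n) set set" where
  "NN_bodies \<phi> = {\<phi> (sublinear_net m \<beta> W) ` cball 0 1 | m \<beta> W.
     1 \<le> m \<and> 0 < \<beta> \<and> (\<forall>x. x \<noteq> 0 \<longrightarrow> 0 < sublinear_net m \<beta> W x)}"

end

theory Submission
  imports Defs
begin

text \<open>By Gibbs' variational principle a sublinear network is a supremum of the sublinear functions
  \<open>x \<mapsto> \<beta> (\<Sum>i. q\<^sub>i (w\<^sub>i \<bullet> x) + \<parallel>x\<parallel> H q)\<close> over probability vectors \<open>q\<close>, the entropy \<open>H q\<close> being
  nonnegative; so it is sublinear. For a positive sublinear \<open>p\<close> the gauge image of the ball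
  is \<open>{p \<le> 1}\<close> and the support image is \<open>{y. \<forall>x. y \<bullet> x \<le> p x}\<close>. Conversely, if \<open>v\<^sub>i\<close> is a finite net
  in a compact set \<open>S\<close>, the networks with \<open>w\<^sub>i = v\<^sub>i / \<beta>\<close> converge to the support function of \<open>S\<close> as
  \<open>\<beta> \<rightarrow> 0\<close> and the net is refined. This is used with \<open>S = K\<close> for the support parametrization and with
  the polar \<open>S = K\<^sup>\<circ>\<close> for the gauge parametrization.\<close>

section \<open>Positive sublinear functions\<close>

lemma convex_bodies0I:
  fixes K :: "(real ^ 'n) set"
  assumes "closed K" "bounded K" "convex K" "0 < r" "cball 0 r \<subseteq> K"
  shows "K \<in> convex_bodies0"
proof -
  have "0 \<in> interior K"
    using assms(4,5) interior_mono[of "cball 0 r" K] by auto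
  then show ?thesis
    using assms by (auto simp: convex_bodies0_def convex_body_def compact_eq_bounded_closed)
qed

locale positive_sublinear =
  fixes p :: "real ^ 'n \<Rightarrow> real"
  assumes subadd: "p (x + y) \<le> p x + p y"
    and hom: "0 \<le> t \<Longrightarrow> p (t *\<^sub>R x) = t * p x"
    and pos: "x \<noteq> 0 \<Longrightarrow> 0 < p x"
begin

lemma zero [simp]: "p 0 = 0"
  using hom[of 0 0] by simp

lemma nonneg: "0 \<le> p x"
  using pos[of x] by (cases "x = 0") auto

lemma convex_on: "convex_on UNIV p"
proof (rule convex_onI)
  fix t x y assume "0 < t" "t < (1::real)"
  then show "p ((1 - t) *\<^sub>R x + t *\<^sub>R y) \<le> (1 - t) * p x + t * p y"
    using subadd[of "(1 - t) *\<^sub>R x" "t *\<^sub>R y"] by (simp add: hom)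
qed auto

lemma continuous: "continuous_on A p"
  using convex_on_continuous[OF open_UNIV convex_on] continuous_on_subset by blast

text \<open>\<open>c\<close> and \<open>C\<close> are the extreme values of \<open>p\<close> on the
  compact unit sphere, carried to all \<open>x\<close> by homogeneity; \<open>c\<close> is positive
  because \<open>p\<close> is. These bounds give both bodies below their boundedness and an interior
  ball around 0.\<close>

lemma norm_bounds:
  obtains c C where "0 < c" "\<And>x. c * norm x \<le> p x" "\<And>x. p x \<le> C * norm x"
proof -
  have ne: "sphere (0 :: real ^ 'n) 1 \<noteq> {}"
    using vector_choose_size[of 1] by (auto simp: dist_norm)
  obtain a where a: "a \<in> sphere 0 1" "\<And>x. x \<in> sphere 0 1 \<Longrightarrow> p a \<le> p x"
    using continuous_attains_inf[OF compact_sphere ne continuous] by blast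
  obtain b where b: "b \<in> sphere 0 1" "\<And>x. x \<in> sphere 0 1 \<Longrightarrow> p x \<le> p b"
    using continuous_attains_sup[OF compact_sphere ne continuous] by blast
  have scale: "p x = norm x * p (x /\<^sub>R norm x)" if "x \<noteq> 0" for x
    using that hom[of "norm x" "x /\<^sub>R norm x"] by simp
  show thesis
  proof (rule that[of "p a" "p b"])
    show "0 < p a" using a(1) by (intro pos) auto
    fix x :: "real ^ 'n"
    show "p a * norm x \<le> p x"
      using a(2)[of "x /\<^sub>R norm x"] scale[of x]
      by (cases "x = 0") (auto simp: mult.commute mult_left_mono)
    show "p x \<le> p b * norm x"
      using b(2)[of "x /\<^sub>R norm x"] scale[of x]
      by (cases "x = 0") (auto simp: mult.commute mult_left_mono)
  qed
qed

section \<open>The bodies with gauge \<open>p\<close> and with support function \<open>p\<close>,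
  and their description as images of the ball\<close>

definition gauge_body :: "(real ^ 'n) set" where
  "gauge_body = {y. p y \<le> 1}"

text \<open>This is the Wulff shape of \<open>p\<close>, equivalently the subdifferential of
  \<open>p\<close> at 0.\<close>

definition support_body :: "(real ^ 'n) set" where
  "support_body = {y. \<forall>x. y \<bullet> x \<le> p x}"

lemma gauge_body: "gauge_body \<in> convex_bodies0"
proof -
  obtain c C where c: "0 < c" "\<And>x. c * norm x \<le> p x" and C: "\<And>x. p x \<le> C * norm x"
    using norm_bounds by blast
  show ?thesis
  proof (rule convex_bodies0I)
    show "closed gauge_body"
      unfolding gauge_body_def by (intro closed_Collect_le continuous continuous_on_const)
    have "norm y \<le> 1 / c" if "y \<in> gauge_body" for y
      using c(2)[of y] c(1) that by (simp add: gauge_body_def field_simps)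
    then show "bounded gauge_body" by (auto simp: bounded_iff)
    show "convex gauge_body"
      unfolding gauge_body_def
    proof (rule convexI, simp)
      fix x y and a b :: real
      assume "p x \<le> 1" "p y \<le> 1" "0 \<le> a" "0 \<le> b" "a + b = 1"
      then show "p (a *\<^sub>R x + b *\<^sub>R y) \<le> 1"
        using subadd[of "a *\<^sub>R x" "b *\<^sub>R y"] convex_bound_le[of "p x" 1 "p y" a b] by (simp add: hom)
    qed
    \<comment> \<open>No sign of \<open>C\<close> is provided, so \<open>\<bar>C\<bar> + 1\<close>
      serves as a positive upper constant.\<close>
    show "0 < 1 / (\<bar>C\<bar> + 1)" by simp
    show "cball 0 (1 / (\<bar>C\<bar> + 1)) \<subseteq> gauge_body"
    proof
      fix x :: "real ^ 'n" assume "x \<in> cball 0 (1 / (\<bar>C\<bar> + 1))"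
      then have "(\<bar>C\<bar> + 1) * norm x \<le> 1" by (simp add: field_simps)
      moreover have "C * norm x \<le> (\<bar>C\<bar> + 1) * norm x" by (intro mult_right_mono) auto
      ultimately show "x \<in> gauge_body" using C[of x] by (simp add: gauge_body_def)
    qed
  qed
qed

lemma support_body: "support_body \<in> convex_bodies0"
proof -
  obtain c C where c: "0 < c" "\<And>x. c * norm x \<le> p x" and C: "\<And>x. p x \<le> C * norm x"
    using norm_bounds by blast
  have eq: "support_body = (\<Inter>x. {y. x \<bullet> y \<le> p x})"
    by (auto simp: support_body_def inner_commute)
  show ?thesis
  proof (rule convex_bodies0I)
    show "closed support_body"
      unfolding eq by (intro closed_INT ballI closed_halfspace_le)
    \<comment> \<open>Test the defining inequality at \<open>x = y\<close> and cancel one factor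
      \<open>norm y\<close>.\<close>
    have "norm y \<le> C" if "y \<in> support_body" "y \<noteq> 0" for y
    proof -
      have "norm y * norm y \<le> C * norm y"
        using that(1) C[of y]
        by (metis (mono_tags) support_body_def mem_Collect_eq order_trans power2_norm_eq_inner power2_eq_square)
      then show ?thesis using that(2) by simp
    qed
    then have "\<forall>y\<in>support_body. norm y \<le> max C 0"
      by (metis max.coboundedI1 max.cobounded2 norm_zero)
    then show "bounded support_body" by (auto simp: bounded_iff)
    show "convex support_body"
      unfolding eq by (intro convex_INT convex_halfspace_le)
    show "0 < c" by fact
    show "cball 0 c \<subseteq> support_body"
    proof
      fix y :: "real ^ 'n" assume y: "y \<in> cball 0 c"
      have "y \<bullet> x \<le> p x" for x
      proof -
        have "y \<bullet> x \<le> norm y * norm x" by (rule norm_cauchy_schwarz)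
        also have "\<dots> \<le> c * norm x" using y by (intro mult_right_mono) auto
        finally show ?thesis using c(2)[of x] by linarith
      qed
      then show "y \<in> support_body" by (simp add: support_body_def)
    qed
  qed
qed

text \<open>For nonzero \<open>x\<close> homogeneity gives
  \<open>p (gauge_param p x) = norm x\<close>, so the map is a radial bijection taking norm balls to
  sublevel sets of \<open>p\<close>. The preimage of \<open>y\<close> is \<open>y\<close> rescaled
  to have norm \<open>p y\<close>.\<close>

lemma gauge_param_image: "gauge_param p ` cball 0 1 = gauge_body"
proof (intro set_eqI iffI)
  fix y assume "y \<in> gauge_param p ` cball 0 1"
  then obtain x where x: "norm x \<le> 1" "y = gauge_param p x" by auto
  show "y \<in> gauge_body"
    using x pos[of x] by (auto simp: gauge_body_def gauge_param_def hom)
next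
  fix y assume y: "y \<in> gauge_body"
  show "y \<in> gauge_param p ` cball 0 1"
  proof (cases "y = 0")
    case True
    then show ?thesis by (intro image_eqI[of _ _ 0]) (auto simp: gauge_param_def)
  next
    case False
    let ?x = "(p y / norm y) *\<^sub>R y"
    have "gauge_param p ?x = y"
      using pos[OF False] False by (simp add: gauge_param_def hom)
    moreover have "?x \<in> cball 0 1"
      using y False nonneg[of y] by (simp add: gauge_body_def)
    ultimately show ?thesis by (metis image_eqI)
  qed
qed

text \<open>Subadditivity and homogeneity bound the difference quotient of \<open>p\<close> at
  \<open>u\<close> in direction \<open>x\<close> by \<open>p x\<close>, and the bound passes to the
  limit \<open>x \<bullet> D\<close>.\<close>

lemma gradient_in_support_body:
  assumes "GDERIV p u :> D"
  shows "D \<in> support_body"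
proof -
  have "D \<bullet> x \<le> p x" for x
  proof -
    have "((\<lambda>t. p (u + t *\<^sub>R x)) has_derivative (\<lambda>t. (t *\<^sub>R x) \<bullet> D)) (at 0)"
    proof -
      have "((\<lambda>t. u + t *\<^sub>R x) has_derivative (\<lambda>t. t *\<^sub>R x)) (at 0)"
        by (auto intro!: derivative_eq_intros)
      moreover have "(p has_derivative (\<lambda>h. h \<bullet> D)) (at (u + 0 *\<^sub>R x))"
        using assms by (simp add: gderiv_def)
      ultimately show ?thesis by (rule has_derivative_compose)
    qed
    then have "((\<lambda>t. p (u + t *\<^sub>R x)) has_real_derivative (x \<bullet> D)) (at 0)"
      by (simp add: has_field_derivative_def mult_commute_abs)
    \<comment> \<open>Only the right-hand limit is taken, since homogeneity bounds the quotient for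
      positive \<open>t\<close> only.\<close>
    then have "((\<lambda>t. (p (u + t *\<^sub>R x) - p u) / t) \<longlongrightarrow> x \<bullet> D) (at_right 0)"
      by (auto simp: DERIV_def intro: tendsto_mono[OF at_le])
    moreover have "\<forall>\<^sub>F t in at_right 0. (p (u + t *\<^sub>R x) - p u) / t \<le> p x"
      unfolding eventually_at_filter
    proof (intro always_eventually allI impI)
      fix t :: real assume "t \<in> {0<..}"
      then show "(p (u + t *\<^sub>R x) - p u) / t \<le> p x"
        using subadd[of u "t *\<^sub>R x"] hom[of t x] by (simp add: field_simps)
    qed
    ultimately have "x \<bullet> D \<le> p x"
      by (intro tendsto_upperbound) auto
    then show ?thesis by (simp add: inner_commute)
  qed
  then show ?thesis by (simp add: support_body_def)
qed

text \<open>Gradients lie in the body, and so do their multiples by \<open>norm x \<le> 1\<close>,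
  because \<open>p\<close> is nonnegative. Conversely a nonzero \<open>y\<close> in the body is
  \<open>l\<close> times a gradient at some unit vector \<open>u\<close>, where \<open>l\<close> in
  \<open>(0, 1]\<close> is the gauge of the body at \<open>y\<close>; as gradients are constant
  along rays, \<open>l *\<^sub>R u\<close> is a preimage.\<close>

lemma support_param_image:
  assumes diff: "\<And>x. x \<noteq> 0 \<Longrightarrow> \<exists>D. GDERIV p x :> D"
  shows "support_param p ` cball 0 1 = support_body"
proof -
  have grad: "GDERIV p x :> gradient p x" if "x \<noteq> 0" for x
    using diff[OF that] gradient_eqI by blast
  show ?thesis
  proof (intro set_eqI iffI)
    fix y assume "y \<in> support_param p ` cball 0 1"
    then obtain x where x: "norm x \<le> 1" "y = support_param p x" by auto
    show "y \<in> support_body"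
    proof (cases "x = 0")
      case True
      then show ?thesis using x nonneg by (simp add: support_param_def support_body_def)
    next
      case False
      have D: "gradient p x \<bullet> z \<le> p z" for z
        using gradient_in_support_body[OF grad[OF False]] by (simp add: support_body_def)
      have "norm x * (gradient p x \<bullet> z) \<le> p z" for z
      proof -
        have "norm x * (gradient p x \<bullet> z) \<le> norm x * p z"
          using D by (intro mult_left_mono) auto
        also have "\<dots> \<le> 1 * p z" using x nonneg by (intro mult_right_mono) auto
        finally show ?thesis by simp
      qed
      then show ?thesis using x False by (simp add: support_param_def support_body_def)
    qed
  next
    fix y assume y: "y \<in> support_body"
    show "y \<in> support_param p ` cball 0 1"
    proof (cases "y = 0")
      case True
      then show ?thesis by (intro image_eqI[of _ _ 0]) (auto simp: support_param_def)
    next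
      case False
      \<comment> \<open>\<open>y\<close> touches the hyperplane with normal \<open>u\<close> after scaling by \<open>1 / l\<close>, so that the function
        \<open>l * p x - y \<bullet> x\<close> is minimal at \<open>u\<close>.\<close>
      have ne: "sphere (0 :: real ^ 'n) 1 \<noteq> {}"
        using vector_choose_size[of 1] by (auto simp: dist_norm)
      have "continuous_on (sphere 0 1) (\<lambda>x. y \<bullet> x / p x)"
        using pos by (intro continuous_intros continuous) (metis less_irrefl norm_zero mem_sphere_0 zero_neq_one)
      from continuous_attains_sup[OF compact_sphere ne this]
      obtain u where u: "norm u = 1"
        and max: "\<And>x. norm x = 1 \<Longrightarrow> y \<bullet> x / p x \<le> y \<bullet> u / p u"
        by auto
      define l where "l = y \<bullet> u / p u"
      have u0: "u \<noteq> 0" using u by auto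
      have le: "y \<bullet> x \<le> l * p x" for x
      proof (cases "x = 0")
        case False
        have "y \<bullet> (x /\<^sub>R norm x) / p (x /\<^sub>R norm x) \<le> l"
          unfolding l_def using False by (intro max) simp
        then show ?thesis
          using False pos[OF False] by (simp add: hom field_simps)
      qed simp
      \<comment> \<open>Testing \<open>le\<close> at \<open>y\<close> itself makes \<open>l\<close>
        positive; membership of \<open>y\<close> in the body makes \<open>l\<close> at most 1, which
        puts \<open>l *\<^sub>R u\<close> into the ball.\<close>
      have "0 < y \<bullet> y" using False by simp
      then have "0 < l" using le[of y] pos[OF False]
        by (metis less_le_trans zero_less_mult_pos2)
      have "l \<le> 1"
        using y pos[OF u0] by (simp add: l_def support_body_def)
      have "((\<lambda>x. l * p x - y \<bullet> x) has_derivative (\<lambda>h. l * (h \<bullet> gradient p u) - y \<bullet> h)) (at u)"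
        using grad[OF u0] by (auto simp: gderiv_def intro!: derivative_eq_intros)
      moreover have "l * p u - y \<bullet> u = 0"
        using pos[OF u0] by (simp add: l_def)
      ultimately have "(\<lambda>h. l * (h \<bullet> gradient p u) - y \<bullet> h) = (\<lambda>h. 0)"
        using le by (intro differential_zero_maxmin[of u UNIV "\<lambda>x. l * p x - y \<bullet> x"]) auto
      then have "h \<bullet> (l *\<^sub>R gradient p u) = h \<bullet> y" for h
        by (simp add: fun_eq_iff inner_commute)
      then have yl: "y = l *\<^sub>R gradient p u"
        by (metis vector_eq_ldot)
      \<comment> \<open>The gradient is homogeneous of degree 0: differentiate the identity
        \<open>p x = l * p (x /\<^sub>R l)\<close> by the chain rule.\<close>
      have "GDERIV p (l *\<^sub>R u) :> gradient p u"
      proof -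
        have "((\<lambda>x. l * p (x /\<^sub>R l)) has_derivative (\<lambda>h. l * ((h /\<^sub>R l) \<bullet> gradient p u))) (at (l *\<^sub>R u))"
        proof -
          have "((\<lambda>x. x /\<^sub>R l) has_derivative (\<lambda>h. h /\<^sub>R l)) (at (l *\<^sub>R u))"
            by (auto intro!: derivative_eq_intros)
          moreover have "(p has_derivative (\<lambda>h. h \<bullet> gradient p u)) (at ((l *\<^sub>R u) /\<^sub>R l))"
            using grad[OF u0] \<open>0 < l\<close> by (simp add: gderiv_def)
          ultimately have "((\<lambda>x. p (x /\<^sub>R l)) has_derivative (\<lambda>h. (h /\<^sub>R l) \<bullet> gradient p u)) (at (l *\<^sub>R u))"
            by (rule has_derivative_compose)
          then show ?thesis by (rule has_derivative_mult_right)
        qed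
        moreover have "(\<lambda>x. l * p (x /\<^sub>R l)) = p"
          using \<open>0 < l\<close> by (auto simp: hom)
        moreover have "(\<lambda>h. l * ((h /\<^sub>R l) \<bullet> gradient p u)) = (\<lambda>h. h \<bullet> gradient p u)"
          using \<open>0 < l\<close> by (simp add: fun_eq_iff field_simps)
        ultimately show ?thesis by (simp only: gderiv_def)
      qed
      then have "gradient p (l *\<^sub>R u) = gradient p u"
        by (rule gradient_eqI)
      then have "y = support_param p (l *\<^sub>R u)"
        using \<open>0 < l\<close> u0 u yl by (simp add: support_param_def)
      moreover have "l *\<^sub>R u \<in> cball 0 1"
        using \<open>0 < l\<close> \<open>l \<le> 1\<close> u by simp
      ultimately show ?thesis by blast
    qed
  qed
qed

end

section \<open>Sublinearity and smoothness of the networks\<close>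

text \<open>This is nonnegativity of the relative entropy of \<open>q\<close> with respect to the
  softmax weights \<open>exp (y i) / S\<close>. Applying \<open>ln z \<le> z - 1\<close> with
  \<open>z = exp (y i) / (q i * S)\<close> and summing with weights \<open>q i\<close> leaves
  \<open>1 - 1 = 0\<close> on the right.\<close>

lemma Gibbs_inequality:
  assumes "\<And>i. i < m \<Longrightarrow> 0 < q i" and "(\<Sum>i<m. q i) = 1"
  shows "(\<Sum>i<m. q i * y i) - (\<Sum>i<m. q i * ln (q i)) \<le> LSE m y"
proof -
  define S where "S = (\<Sum>i<m. exp (y i))"
  have "m \<noteq> 0" using assms(2) by (cases m) auto
  then have S: "0 < S" unfolding S_def by (intro sum_pos) auto
  have "q i * (y i - ln (q i) - ln S) \<le> exp (y i) / S - q i" if "i < m" for i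
  proof -
    have q: "0 < q i" using assms(1) that .
    have "y i - ln (q i) - ln S = ln (exp (y i) / (q i * S))"
      using q S by (simp add: ln_div ln_mult)
    also have "\<dots> \<le> exp (y i) / (q i * S) - 1"
      using q S by (intro ln_le_minus_one) simp
    finally have "q i * (y i - ln (q i) - ln S) \<le> q i * (exp (y i) / (q i * S) - 1)"
      using q by (intro mult_left_mono) auto
    also have "\<dots> = exp (y i) / S - q i"
      using q S by (simp add: field_simps)
    finally show ?thesis .
  qed
  then have "(\<Sum>i<m. q i * (y i - ln (q i) - ln S)) \<le> (\<Sum>i<m. exp (y i) / S - q i)"
    by (intro sum_mono) auto
  also have "\<dots> = 0"
    using S assms(2) by (simp add: sum_subtractf sum_divide_distrib[symmetric] flip: S_def)
  also have "(\<Sum>i<m. q i * (y i - ln (q i) - ln S)) =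
      (\<Sum>i<m. q i * y i) - (\<Sum>i<m. q i * ln (q i)) - (\<Sum>i<m. q i) * ln S"
    by (simp add: algebra_simps sum_subtractf sum.distrib sum_distrib_left sum_distrib_right)
  finally show ?thesis using assms(2) by (simp add: LSE_def S_def)
qed

text \<open>The maximizer is the softmax vector \<open>exp (y i) / S\<close>, for which
  \<open>ln (q i) = y i - ln S\<close>.\<close>

lemma Gibbs_equality:
  fixes y :: "nat \<Rightarrow> real"
  assumes "1 \<le> m"
  obtains q where "\<And>i. i < m \<Longrightarrow> 0 < q i" "(\<Sum>i<m. q i) = 1"
    "LSE m y = (\<Sum>i<m. q i * y i) - (\<Sum>i<m. q i * ln (q i))"
proof -
  define S where "S = (\<Sum>i<m. exp (y i))"
  have S: "0 < S" unfolding S_def using assms by (intro sum_pos) (auto simp: lessThan_empty_iff)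
  define q where "q i = exp (y i) / S" for i
  have q1: "(\<Sum>i<m. q i) = 1"
    using S by (simp add: q_def sum_divide_distrib[symmetric] flip: S_def)
  have "(\<Sum>i<m. q i * ln (q i)) = (\<Sum>i<m. q i * y i - q i * ln S)"
    using S by (intro sum.cong) (auto simp: q_def ln_div diff_divide_distrib algebra_simps)
  also have "\<dots> = (\<Sum>i<m. q i * y i) - ln S"
    using q1 by (simp add: sum_subtractf sum_distrib_right[symmetric])
  finally show thesis
    using q1 S by (intro that[of q]) (auto simp: q_def LSE_def S_def)
qed

text \<open>Each weight is at most the total 1, so its logarithm is nonpositive. This sign makes the
  norm term of the network enter with a nonnegative coefficient.\<close>

lemma entropy_nonneg:
  fixes q :: "nat \<Rightarrow> real"
  assumes "\<And>i. i < m \<Longrightarrow> 0 < q i" and "(\<Sum>i<m. q i) = 1"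
  shows "(\<Sum>i<m. q i * ln (q i)) \<le> 0"
proof (rule sum_nonpos)
  fix i assume i: "i \<in> {..<m}"
  have "q i \<le> (\<Sum>i<m. q i)"
    using assms(1) i by (intro member_le_sum) (auto simp: less_imp_le)
  then show "q i * ln (q i) \<le> 0"
    using assms i by (intro mult_nonneg_nonpos) (auto simp: less_imp_le)
qed

section \<open>Sublinearity of the networks\<close>

lemma sublinear_net_hom:
  assumes "0 \<le> t"
  shows "sublinear_net m \<beta> W (t *\<^sub>R x) = t * sublinear_net m \<beta> W x"
proof (cases "t = 0 \<or> x = 0")
  case False
  then have "(t *\<^sub>R x) /\<^sub>R norm (t *\<^sub>R x) = x /\<^sub>R norm x"
    using assms by simp
  then have "LSE m (\<lambda>i. W i \<bullet> ((t *\<^sub>R x) /\<^sub>R norm (t *\<^sub>R x))) = LSE m (\<lambda>i. W i \<bullet> (x /\<^sub>R norm x))"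
    by (simp only:)
  then show ?thesis
    using False assms unfolding sublinear_net_def
    by (simp del: inner_scaleR_right scaleR_scaleR norm_scaleR add: norm_scaleR[of t x])
qed (auto simp: sublinear_net_def)

text \<open>Gibbs' inequality in the direction of \<open>x\<close>, multiplied by
  \<open>\<beta> * norm x\<close>: the linear part absorbs the norm, the entropy keeps it. One fixed
  \<open>q\<close> bounds the network from below at every point.\<close>

lemma sublinear_net_ge:
  assumes "0 \<le> \<beta>" "\<And>i. i < m \<Longrightarrow> 0 < q i" "(\<Sum>i<m. q i) = 1"
  shows "\<beta> * ((\<Sum>i<m. q i * (W i \<bullet> x)) - norm x * (\<Sum>i<m. q i * ln (q i))) \<le> sublinear_net m \<beta> W x"
proof (cases "x = 0")
  case False
  have "norm x * ((\<Sum>i<m. q i * (W i \<bullet> (x /\<^sub>R norm x))) - (\<Sum>i<m. q i * ln (q i)))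
      \<le> norm x * LSE m (\<lambda>i. W i \<bullet> (x /\<^sub>R norm x))"
    using assms(2,3) by (intro mult_left_mono Gibbs_inequality) auto
  moreover have "norm x * (\<Sum>i<m. q i * (W i \<bullet> (x /\<^sub>R norm x))) = (\<Sum>i<m. q i * (W i \<bullet> x))"
    using False unfolding sum_distrib_left by (intro sum.cong) (auto simp: field_simps)
  ultimately show ?thesis
    using False assms(1) unfolding sublinear_net_def mult.assoc right_diff_distrib[of "norm x"]
    by (simp add: mult_left_mono del: inner_scaleR_right)
qed (simp add: sublinear_net_def)

text \<open>Take \<open>q\<close> optimal at \<open>x + y\<close> and use the same \<open>q\<close>
  for the lower bounds at \<open>x\<close> and \<open>y\<close>. The linear part is additive and the
  entropy part is a nonnegative multiple of the norm.\<close>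

lemma sublinear_net_subadd:
  assumes "1 \<le> m" "0 \<le> \<beta>"
  shows "sublinear_net m \<beta> W (x + y) \<le> sublinear_net m \<beta> W x + sublinear_net m \<beta> W y"
proof -
  obtain q where q: "\<And>i. i < m \<Longrightarrow> 0 < q i" "(\<Sum>i<m. q i) = 1"
    and eq: "LSE m (\<lambda>i. W i \<bullet> ((x + y) /\<^sub>R norm (x + y))) =
      (\<Sum>i<m. q i * (W i \<bullet> ((x + y) /\<^sub>R norm (x + y)))) - (\<Sum>i<m. q i * ln (q i))"
    using Gibbs_equality[OF assms(1)] by blast
  define E where "E = (\<Sum>i<m. q i * ln (q i))"
  define L where "L z = (\<Sum>i<m. q i * (W i \<bullet> z))" for z
  have L: "L (x + y) = L x + L y"
    by (simp add: L_def inner_add_right algebra_simps sum.distrib)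
  have "E \<le> 0" unfolding E_def using q by (rule entropy_nonneg)
  \<comment> \<open>If \<open>x + y = 0\<close>, both sides vanish whatever \<open>q\<close> is, by
    the value of the network at 0.\<close>
  have "sublinear_net m \<beta> W (x + y) = \<beta> * (L (x + y) - norm (x + y) * E)"
  proof (cases "x + y = 0")
    case False
    have "norm (x + y) * L ((x + y) /\<^sub>R norm (x + y)) = L (x + y)"
      using False unfolding L_def sum_distrib_left
      by (intro sum.cong) (auto simp: mult.left_commute[of "norm (x + y)"])
    moreover have "LSE m (\<lambda>i. W i \<bullet> ((x + y) /\<^sub>R norm (x + y))) = L ((x + y) /\<^sub>R norm (x + y)) - E"
      unfolding L_def E_def by (rule eq)
    ultimately show ?thesis
      using False by (simp only: sublinear_net_def right_diff_distrib mult.assoc if_False)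
  qed (simp add: sublinear_net_def L_def)
  \<comment> \<open>Multiplication by \<open>E \<le> 0\<close> reverses the triangle
    inequality.\<close>
  also have "\<dots> \<le> \<beta> * (L x + L y - (norm x + norm y) * E)"
    using \<open>E \<le> 0\<close> assms(2) norm_triangle_ineq[of x y]
    unfolding L by (intro mult_left_mono diff_left_mono mult_right_mono_neg) auto
  also have "\<dots> = \<beta> * (L x - norm x * E) + \<beta> * (L y - norm y * E)"
    by (simp add: algebra_simps)
  also have "\<dots> \<le> sublinear_net m \<beta> W x + sublinear_net m \<beta> W y"
    unfolding L_def E_def by (intro add_mono sublinear_net_ge assms(2) q)
  finally show ?thesis .
qed

section \<open>Differentiability away from the origin\<close>

lemma differentiable_imp_GDERIV:
  fixes f :: "'a::euclidean_space \<Rightarrow> real"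
  assumes "f differentiable at x"
  shows "\<exists>D. GDERIV f x :> D"
proof -
  obtain f' where f': "(f has_derivative f') (at x)"
    using assms by (auto simp: differentiable_def)
  then have lin: "linear f'" by (rule has_derivative_linear)
  \<comment> \<open>Riesz representation in coordinates: the representing vector has the values of
    \<open>f'\<close> on the basis as its entries.\<close>
  have "f' = (\<lambda>h. h \<bullet> (\<Sum>b\<in>Basis. f' b *\<^sub>R b))"
  proof
    fix h
    have "f' h = f' (\<Sum>b\<in>Basis. (h \<bullet> b) *\<^sub>R b)" by (simp add: euclidean_representation)
    also have "\<dots> = h \<bullet> (\<Sum>b\<in>Basis. f' b *\<^sub>R b)"
      using lin by (simp add: linear_sum linear_scale inner_sum_right mult.commute)
    finally show "f' h = h \<bullet> (\<Sum>b\<in>Basis. f' b *\<^sub>R b)" .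
  qed
  then show ?thesis using f' by (metis gderiv_def)
qed

lemma sublinear_net_GDERIV:
  assumes "1 \<le> m" "x \<noteq> 0"
  shows "\<exists>D. GDERIV (sublinear_net m \<beta> W) x :> D"
proof (rule differentiable_imp_GDERIV)
  have n: "norm differentiable at x"
    using assms(2) by (rule differentiable_norm_at)
  have u: "(\<lambda>x. x /\<^sub>R norm x) differentiable at x"
    using assms(2) n by (intro differentiable_scaleR differentiable_inverse) auto
  have "(\<lambda>x. exp (W i \<bullet> (x /\<^sub>R norm x))) differentiable at x" for i
  proof -
    have "(\<lambda>x. W i \<bullet> (x /\<^sub>R norm x)) differentiable at x"
      using u by (intro differentiable_inner) auto
    then show ?thesis
      unfolding differentiable_def by (auto intro: has_derivative_exp)
  qed
  then have "(\<lambda>x. \<Sum>i<m. exp (W i \<bullet> (x /\<^sub>R norm x))) differentiable at x"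
    by (intro differentiable_sum) auto
  moreover have "0 < (\<Sum>i<m. exp (W i \<bullet> (x /\<^sub>R norm x)))"
    using assms(1) by (intro sum_pos) (auto simp: lessThan_empty_iff)
  ultimately have "(\<lambda>x. LSE m (\<lambda>i. W i \<bullet> (x /\<^sub>R norm x))) differentiable at x"
    unfolding differentiable_def LSE_def by (auto intro: has_derivative_ln)
  then have "(\<lambda>x. \<beta> * norm x * LSE m (\<lambda>i. W i \<bullet> (x /\<^sub>R norm x))) differentiable at x"
    using n by (intro differentiable_mult) auto
  then obtain f' where f': "((\<lambda>x. \<beta> * norm x * LSE m (\<lambda>i. W i \<bullet> (x /\<^sub>R norm x))) has_derivative f') (at x)"
    by (auto simp: differentiable_def)
  \<comment> \<open>The network agrees with the differentiated formula only off the origin, so the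
    derivative is transferred within the open set \<open>- {0}\<close>.\<close>
  have "(sublinear_net m \<beta> W has_derivative f') (at x)"
    using f'
    by (rule has_derivative_transform_within_open[where s = "- {0}"])
      (use assms(2) in \<open>auto simp: sublinear_net_def\<close>)
  then show "sublinear_net m \<beta> W differentiable at x"
    by (auto simp: differentiable_def)
qed

lemma positive_sublinear_net:
  assumes "1 \<le> m" "0 < \<beta>" "\<And>x. x \<noteq> 0 \<Longrightarrow> 0 < sublinear_net m \<beta> W x"
  shows "positive_sublinear (sublinear_net m \<beta> W)"
  using assms by unfold_locales (auto simp: sublinear_net_hom sublinear_net_subadd)

section \<open>Approximation of support functions\<close>

text \<open>Log-sum-exp dominates each of its arguments. The columns are
  \<open>v i /\<^sub>R \<beta>\<close> so that the outer factor \<open>\<beta>\<close>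
  cancels.\<close>

lemma sublinear_net_lower:
  assumes "0 < \<beta>" "i < m"
  shows "v i \<bullet> x \<le> sublinear_net m \<beta> (\<lambda>i. v i /\<^sub>R \<beta>) x"
proof (cases "x = 0")
  case False
  let ?y = "\<lambda>i. (v i /\<^sub>R \<beta>) \<bullet> (x /\<^sub>R norm x)"
  have "exp (?y i) \<le> (\<Sum>i<m. exp (?y i))"
    using assms(2) by (intro member_le_sum) auto
  then have y: "?y i \<le> LSE m ?y"
    unfolding LSE_def by (metis exp_gt_zero less_le_trans ln_exp ln_mono)
  have "v i \<bullet> x = \<beta> * norm x * ?y i"
    using False assms(1) by (simp add: field_simps)
  also have "\<dots> \<le> \<beta> * norm x * LSE m ?y"
    using y assms(1) by (intro mult_left_mono) auto
  finally show ?thesis using False by (simp add: sublinear_net_def)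
qed (simp add: sublinear_net_def)

text \<open>Replacing all \<open>m\<close> exponentials by the largest one gives
  \<open>LSE \<le> max + ln m\<close>; \<open>i\<close> is an index attaining the maximum and
  depends on \<open>x\<close>.\<close>

lemma sublinear_net_upper:
  assumes "0 < \<beta>" "1 \<le> m"
  shows "\<exists>i<m. sublinear_net m \<beta> (\<lambda>i. v i /\<^sub>R \<beta>) x \<le> v i \<bullet> x + \<beta> * ln m * norm x"
proof (cases "x = 0")
  case True
  then show ?thesis using assms by (intro exI[of _ 0]) (simp add: sublinear_net_def)
next
  case False
  let ?y = "\<lambda>i. (v i /\<^sub>R \<beta>) \<bullet> (x /\<^sub>R norm x)"
  have "?y ` {..<m} \<noteq> {}" using assms(2) by (auto simp: lessThan_empty_iff)
  then have "Max (?y ` {..<m}) \<in> ?y ` {..<m}" by (intro Max_in) auto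
  then obtain i where i: "i < m" "?y i = Max (?y ` {..<m})" by auto
  have "?y j \<le> ?y i" if "j < m" for j
    unfolding i(2) using that by (intro Max_ge) auto
  then have "(\<Sum>j<m. exp (?y j)) \<le> (\<Sum>j<m. exp (?y i))"
    by (intro sum_mono) auto
  moreover have "0 < (\<Sum>j<m. exp (?y j))"
    using assms(2) by (intro sum_pos) (auto simp: lessThan_empty_iff)
  ultimately have "LSE m ?y \<le> ln (m * exp (?y i))"
    unfolding LSE_def by simp
  also have "\<dots> = ln m + ?y i"
    using assms(2) by (simp add: ln_mult)
  finally have "\<beta> * norm x * LSE m ?y \<le> \<beta> * norm x * (ln m + ?y i)"
    using assms(1) by (intro mult_left_mono) auto
  also have "\<dots> = v i \<bullet> x + \<beta> * ln m * norm x"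
    using False assms(1) by (simp add: field_simps)
  finally show ?thesis using False i(1) by (auto simp: sublinear_net_def)
qed

text \<open>The network approximates the support function of \<open>S\<close>, expressed through
  points of \<open>S\<close> instead of a supremum. The lower bound \<open>r * norm x\<close> on
  that function turns an additive error \<open>\<epsilon> * norm x\<close> into a relative one, and
  relative errors become inclusions between scaled bodies.\<close>

lemma sublinear_net_approx:
  fixes S :: "(real ^ 'n) set"
  assumes S: "compact S" and r: "0 < r" "\<And>x. \<exists>w\<in>S. r * norm x \<le> w \<bullet> x" and \<delta>: "0 < \<delta>"
  obtains m \<beta> W where "1 \<le> m" "0 < \<beta>" "\<And>x. x \<noteq> 0 \<Longrightarrow> 0 < sublinear_net m \<beta> W x"
    "\<And>w x. w \<in> S \<Longrightarrow> w \<bullet> x \<le> (1 + \<delta>) * sublinear_net m \<beta> W x"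
    "\<And>x. \<exists>w\<in>S. sublinear_net m \<beta> W x \<le> (1 + \<delta>) * (w \<bullet> x)"
proof -
  \<comment> \<open>The bound \<open>r / 4\<close> keeps \<open>p x\<close> above
    \<open>3 / 4 * (r * norm x)\<close> and the matching \<open>w \<bullet> x\<close> above half of
    \<open>r * norm x\<close>; the bound \<open>\<delta> * r / 2\<close> then makes the additive
    error at most \<open>\<delta>\<close> times either quantity.\<close>
  define \<epsilon> where "\<epsilon> = min (r / 4) (\<delta> * r / 2)"
  have \<epsilon>: "0 < \<epsilon>" "\<epsilon> \<le> r / 4" "\<epsilon> \<le> \<delta> * (r / 2)"
    using r(1) \<delta> by (auto simp: \<epsilon>_def)
  obtain V where V: "finite V" "V \<subseteq> S" "S \<subseteq> (\<Union>v\<in>V. ball v \<epsilon>)"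
    using compactE_image[OF S, of S "\<lambda>v. ball v \<epsilon>"] \<epsilon>(1) by (metis UN_I centre_in_ball open_ball subsetI)
  define m where "m = card V"
  obtain v where "bij_betw v {..<m} V"
    unfolding m_def using ex_bij_betw_nat_finite[OF V(1)] by (auto simp: atLeast0LessThan)
  then have v: "v ` {..<m} = V" by (simp add: bij_betw_def)
  have "S \<noteq> {}" using r(2) by blast
  then have m: "1 \<le> m" using V by (auto simp: m_def Suc_le_eq card_gt_0_iff)
  \<comment> \<open>The smoothing parameter is chosen after the net, whose size \<open>m\<close>
    depends on \<open>\<epsilon>\<close>. The summand 1 avoids a zero denominator when
    \<open>m = 1\<close>.\<close>
  define \<beta> where "\<beta> = \<epsilon> / (ln m + 1)"
  have lnm: "0 \<le> ln (real m)" using m by simp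
  have \<beta>: "0 < \<beta>" "\<beta> * ln m \<le> \<epsilon>"
    using \<epsilon>(1) lnm by (auto simp: \<beta>_def field_simps)
  define p where "p = sublinear_net m \<beta> (\<lambda>i. v i /\<^sub>R \<beta>)"
  have low: "w \<bullet> x \<le> p x + \<epsilon> * norm x" if w: "w \<in> S" for w x
  proof -
    obtain i where i: "i < m" "dist (v i) w < \<epsilon>"
      using subsetD[OF V(3) w] by (auto simp flip: v)
    have "w \<bullet> x = v i \<bullet> x + (w - v i) \<bullet> x" by (simp add: inner_diff_left)
    also have "(w - v i) \<bullet> x \<le> norm (w - v i) * norm x" by (rule norm_cauchy_schwarz)
    also have "\<dots> \<le> \<epsilon> * norm x"
      using i(2) by (intro mult_right_mono) (auto simp: dist_norm norm_minus_commute)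
    finally show ?thesis
      using sublinear_net_lower[OF \<beta>(1) i(1), of v x] unfolding p_def by linarith
  qed
  have upp: "\<exists>w\<in>S. p x \<le> w \<bullet> x + \<epsilon> * norm x" for x
  proof -
    obtain i where i: "i < m" "p x \<le> v i \<bullet> x + \<beta> * ln m * norm x"
      using sublinear_net_upper[OF \<beta>(1) m, of v x] unfolding p_def by blast
    moreover have "\<beta> * ln m * norm x \<le> \<epsilon> * norm x" using \<beta>(2) by (intro mult_right_mono) auto
    ultimately show ?thesis using v V(2) by (intro bexI[of _ "v i"]) auto
  qed
  have eps4: "\<epsilon> * norm x \<le> (r * norm x) / 4" for x :: "real ^ 'n"
    using mult_right_mono[OF \<epsilon>(2), of "norm x"] by simp
  have epsd: "\<epsilon> * norm x \<le> \<delta> * t" if "(r * norm x) / 2 \<le> t" for x :: "real ^ 'n" and t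
  proof -
    have "\<epsilon> * norm x \<le> \<delta> * (r / 2) * norm x" using \<epsilon>(3) by (intro mult_right_mono) auto
    also have "\<dots> \<le> \<delta> * t" using mult_left_mono[OF that, of \<delta>] \<delta> by simp
    finally show ?thesis .
  qed
  \<comment> \<open>The point of \<open>S\<close> supplied by \<open>r(2)\<close> has inner product
    at least \<open>r * norm x\<close> with \<open>x\<close>, and \<open>low\<close> costs at most a
    quarter of that.\<close>
  have p34: "3 / 4 * (r * norm x) \<le> p x" for x
    using r(2)[of x] low[of _ x] eps4[of x] by fastforce
  show thesis
  proof (rule that[of m \<beta> "\<lambda>i. v i /\<^sub>R \<beta>", folded p_def])
    show "0 < p x" if "x \<noteq> 0" for x
    proof -
      have "0 < r * norm x" using that r(1) by simp
      then show ?thesis using p34[of x] by linarith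
    qed
    show "w \<bullet> x \<le> (1 + \<delta>) * p x" if "w \<in> S" for w x
    proof -
      have "0 \<le> r * norm x" using r(1) by simp
      then have "\<epsilon> * norm x \<le> \<delta> * p x" using p34[of x] by (intro epsd) linarith
      then show ?thesis using low[OF that, of x] by (simp add: algebra_simps)
    qed
    show "\<exists>w\<in>S. p x \<le> (1 + \<delta>) * (w \<bullet> x)" for x
    proof -
      obtain w where w: "w \<in> S" "p x \<le> w \<bullet> x + \<epsilon> * norm x" using upp by blast
      then have "\<epsilon> * norm x \<le> \<delta> * (w \<bullet> x)"
        using p34[of x] eps4[of x] by (intro epsd) linarith
      then show ?thesis using w by (intro bexI[of _ w]) (auto simp: algebra_simps)
    qed
  qed (use m \<beta> in auto)
qed

section \<open>Density\<close>

text \<open>In both directions the shrunk point \<open>x /\<^sub>R (1 + \<delta>)\<close> is the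
  nearby point of the other set, at distance \<open>\<delta>\<close> times its own norm.\<close>

lemma hausdorff_dist_le_scaling:
  fixes K L :: "(real ^ 'n) set"
  assumes ne: "K \<noteq> {}" "L \<noteq> {}" and R: "\<And>x. x \<in> K \<Longrightarrow> norm x \<le> R" and \<delta>: "0 < \<delta>"
    and KL: "\<And>x. x \<in> K \<Longrightarrow> x /\<^sub>R (1 + \<delta>) \<in> L" and LK: "\<And>x. x \<in> L \<Longrightarrow> x /\<^sub>R (1 + \<delta>) \<in> K"
  shows "hausdorff_dist K L \<le> \<delta> * R"
proof -
  have dist: "dist x (x /\<^sub>R (1 + \<delta>)) = \<delta> * norm (x /\<^sub>R (1 + \<delta>))" for x :: "real ^ 'n"
  proof -
    have "x - x /\<^sub>R (1 + \<delta>) = \<delta> *\<^sub>R (x /\<^sub>R (1 + \<delta>))"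
    proof -
      have "x = ((1 + \<delta>) * inverse (1 + \<delta>)) *\<^sub>R x" using \<delta> by simp
      then have "x = (1 + \<delta>) *\<^sub>R (x /\<^sub>R (1 + \<delta>))" by simp
      then show ?thesis by (metis add_diff_cancel_left' scaleR_left_distrib scaleR_one)
    qed
    then show ?thesis using \<delta> by (simp add: dist_norm)
  qed
  have "infdist x L \<le> \<delta> * R" if "x \<in> K" for x
  proof -
    have "infdist x L \<le> dist x (x /\<^sub>R (1 + \<delta>))" using KL[OF that] by (rule infdist_le)
    also have "\<dots> = \<delta> * (norm x / (1 + \<delta>))" unfolding dist using \<delta> by (simp add: divide_inverse mult.commute)
    also have "\<dots> \<le> \<delta> * norm x"
      using \<delta> by (intro mult_left_mono) (auto simp: divide_le_eq algebra_simps)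
    also have "\<dots> \<le> \<delta> * R" using R[OF that] \<delta> by (intro mult_left_mono) auto
    finally show ?thesis .
  qed
  \<comment> \<open>No bound on \<open>L\<close> is needed here: the shrunk point lies in
    \<open>K\<close>, so its norm is at most \<open>R\<close>.\<close>
  moreover have "infdist x K \<le> \<delta> * R" if "x \<in> L" for x
  proof -
    have "infdist x K \<le> dist x (x /\<^sub>R (1 + \<delta>))" using LK[OF that] by (rule infdist_le)
    also have "\<dots> \<le> \<delta> * R" unfolding dist using R[OF LK[OF that]] \<delta> by (intro mult_left_mono) auto
    finally show ?thesis .
  qed
  ultimately show ?thesis
    unfolding hausdorff_dist_def using ne by (auto intro!: cSUP_least)
qed

text \<open>The network approximates the support function of \<open>K\<close> itself. The upper
  estimate for \<open>K\<close> gives one inclusion at once; the other follows by separating a point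
  from \<open>K\<close>.\<close>

lemma support_param_approx:
  fixes K :: "(real ^ 'n) set"
  assumes K: "compact K" "convex K" and r: "0 < r" "cball 0 r \<subseteq> K" and \<delta>: "0 < \<delta>"
  shows "\<exists>\<Omega>\<in>NN_bodies support_param.
    (\<forall>x\<in>K. x /\<^sub>R (1 + \<delta>) \<in> \<Omega>) \<and> (\<forall>x\<in>\<Omega>. x /\<^sub>R (1 + \<delta>) \<in> K)"
proof -
  have "\<exists>w\<in>K. r * norm x \<le> w \<bullet> x" for x
  proof (rule bexI)
    \<comment> \<open>This is the point of the ball of radius \<open>r\<close> in direction
      \<open>x\<close>; for \<open>x = 0\<close> it is 0, as division by zero yields 0.\<close>
    show "(r / norm x) *\<^sub>R x \<in> K" using r by (intro subsetD[OF r(2)]) auto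
    show "r * norm x \<le> (r / norm x) *\<^sub>R x \<bullet> x"
      by (cases "x = 0") (simp_all add: dot_square_norm power2_eq_square)
  qed
  then obtain m \<beta> W where net: "1 \<le> m" "0 < \<beta>" "\<And>x. x \<noteq> 0 \<Longrightarrow> 0 < sublinear_net m \<beta> W x"
    and low: "\<And>w x. w \<in> K \<Longrightarrow> w \<bullet> x \<le> (1 + \<delta>) * sublinear_net m \<beta> W x"
    and upp: "\<And>x. \<exists>w\<in>K. sublinear_net m \<beta> W x \<le> (1 + \<delta>) * (w \<bullet> x)"
    using sublinear_net_approx[OF K(1) r(1) _ \<delta>] by blast
  define p where "p = sublinear_net m \<beta> W"
  interpret positive_sublinear p
    unfolding p_def using net by (rule positive_sublinear_net)
  have im: "support_param p ` cball 0 1 = support_body"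
    unfolding p_def by (rule support_param_image[unfolded p_def]) (rule sublinear_net_GDERIV[OF net(1)])
  have "support_body \<in> NN_bodies support_param"
    unfolding NN_bodies_def mem_Collect_eq using net im
    by (intro exI[of _ m] exI[of _ \<beta>] exI[of _ W]) (auto simp: p_def)
  moreover have "x /\<^sub>R (1 + \<delta>) \<in> support_body" if "x \<in> K" for x
  proof -
    have "(x /\<^sub>R (1 + \<delta>)) \<bullet> z = (x \<bullet> z) / (1 + \<delta>)" for z
      by (simp add: divide_inverse_commute)
    then show ?thesis
      using low[OF that, folded p_def] \<delta> by (simp add: support_body_def pos_divide_le_eq mult.commute)
  qed
  moreover have "y /\<^sub>R (1 + \<delta>) \<in> K" if y: "y \<in> support_body" for y
  proof (rule ccontr)
    assume "y /\<^sub>R (1 + \<delta>) \<notin> K"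
    then obtain a b where ab: "a \<bullet> (y /\<^sub>R (1 + \<delta>)) < b" "\<forall>w\<in>K. b < a \<bullet> w"
      using separating_hyperplane_closed_point[OF K(2) compact_imp_closed[OF K(1)]] by blast
    \<comment> \<open>The point lies on the lower side of the hyperplane, so the outward normal of
      \<open>K\<close> is \<open>- a\<close>.\<close>
    obtain w where w: "w \<in> K" "p (- a) \<le> (1 + \<delta>) * (w \<bullet> (- a))"
      using upp[of "- a"] by (auto simp: p_def)
    have "y \<bullet> (- a) \<le> (1 + \<delta>) * (w \<bullet> (- a))"
      using y w(2) order_trans unfolding support_body_def by blast
    then have "a \<bullet> w \<le> a \<bullet> (y /\<^sub>R (1 + \<delta>))"
      using \<delta> by (simp add: inner_commute field_simps)
    then show False using ab w(1) by fastforce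
  qed
  ultimately show ?thesis by blast
qed

text \<open>The network approximates the support function of the polar of \<open>K\<close>, which is
  the gauge of \<open>K\<close>. The second inclusion is a quantitative bipolar argument.\<close>

lemma gauge_param_approx:
  fixes K :: "(real ^ 'n) set"
  assumes K: "compact K" "convex K" and r: "0 < r" "cball 0 r \<subseteq> K" and \<delta>: "0 < \<delta>"
  shows "\<exists>\<Omega>\<in>NN_bodies gauge_param.
    (\<forall>x\<in>K. x /\<^sub>R (1 + \<delta>) \<in> \<Omega>) \<and> (\<forall>x\<in>\<Omega>. x /\<^sub>R (1 + \<delta>) \<in> K)"
proof -
  define P where "P = {w. \<forall>y\<in>K. y \<bullet> w \<le> 1}"
  obtain R where R: "0 < R" "\<And>x. x \<in> K \<Longrightarrow> norm x \<le> R"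
    using compact_imp_bounded[OF K(1)] by (auto simp: bounded_pos)
  have "closed P"
  proof -
    have "P = (\<Inter>y\<in>K. {w. y \<bullet> w \<le> 1})" by (auto simp: P_def)
    then show ?thesis by (simp add: closed_INT closed_halfspace_le)
  qed
  moreover have "norm w \<le> 1 / r" if "w \<in> P" for w
  proof (cases "w = 0")
    case False
    have "(r / norm w) *\<^sub>R w \<in> K" using r by (intro subsetD[OF r(2)]) auto
    then have "(r / norm w) *\<^sub>R w \<bullet> w \<le> 1" using that by (auto simp: P_def)
    then have "r * norm w \<le> 1" using False by (simp add: dot_square_norm power2_eq_square)
    then show ?thesis using r(1) by (simp add: field_simps)
  qed (use r in simp)
  then have "bounded P" by (auto simp: bounded_iff)
  ultimately have P: "compact P" by (simp add: compact_eq_bounded_closed)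
  \<comment> \<open>\<open>K\<close> lies in the ball of radius \<open>R\<close>, so its polar
    contains the ball of radius \<open>1 / R\<close>; the witness is the point of that ball in
    direction \<open>x\<close>, and 0 if \<open>x = 0\<close>.\<close>
  have "\<exists>w\<in>P. (1 / R) * norm x \<le> w \<bullet> x" for x
  proof (rule bexI)
    let ?w = "(1 / (R * norm x)) *\<^sub>R x"
    show "(1 / R) * norm x \<le> ?w \<bullet> x"
      by (cases "x = 0") (simp_all add: dot_square_norm power2_eq_square)
    have "y \<bullet> ?w \<le> 1" if "y \<in> K" for y
    proof -
      have "y \<bullet> ?w \<le> norm y * norm ?w" by (rule norm_cauchy_schwarz)
      also have "\<dots> \<le> R * (1 / R)"
        using R that by (intro mult_mono) auto
      finally show ?thesis using R(1) by simp
    qed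
    then show "?w \<in> P" by (simp add: P_def)
  qed
  moreover have "0 < 1 / R" using R(1) by simp
  ultimately obtain m \<beta> W where net: "1 \<le> m" "0 < \<beta>" "\<And>x. x \<noteq> 0 \<Longrightarrow> 0 < sublinear_net m \<beta> W x"
    and low: "\<And>w x. w \<in> P \<Longrightarrow> w \<bullet> x \<le> (1 + \<delta>) * sublinear_net m \<beta> W x"
    and upp: "\<And>x. \<exists>w\<in>P. sublinear_net m \<beta> W x \<le> (1 + \<delta>) * (w \<bullet> x)"
    using sublinear_net_approx[OF P _ _ \<delta>] by blast
  define p where "p = sublinear_net m \<beta> W"
  interpret positive_sublinear p
    unfolding p_def using net by (rule positive_sublinear_net)
  have "gauge_body \<in> NN_bodies gauge_param"
    unfolding NN_bodies_def mem_Collect_eq using net gauge_param_image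
    by (intro exI[of _ m] exI[of _ \<beta>] exI[of _ W]) (auto simp: p_def)
  moreover have "x /\<^sub>R (1 + \<delta>) \<in> gauge_body" if "x \<in> K" for x
  proof -
    obtain w where w: "w \<in> P" "p x \<le> (1 + \<delta>) * (w \<bullet> x)" using upp by (auto simp: p_def)
    have "w \<bullet> x \<le> 1" using w(1) that by (auto simp: P_def inner_commute)
    then have "(1 + \<delta>) * (w \<bullet> x) \<le> (1 + \<delta>) * 1" using \<delta> by (intro mult_left_mono) auto
    then have "p x \<le> 1 + \<delta>" using w(2) by simp
    then show ?thesis using \<delta> by (simp add: gauge_body_def hom field_simps)
  qed
  moreover have "y /\<^sub>R (1 + \<delta>) \<in> K" if y: "y \<in> gauge_body" for y
  proof (rule ccontr)
    assume "y /\<^sub>R (1 + \<delta>) \<notin> K"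
    then obtain a b where ab: "a \<bullet> (y /\<^sub>R (1 + \<delta>)) < b" "\<forall>w\<in>K. b < a \<bullet> w"
      using separating_hyperplane_closed_point[OF K(2) compact_imp_closed[OF K(1)]] by blast
    have "0 \<in> K" using r by (intro subsetD[OF r(2)]) auto
    then have b: "b < 0" using ab(2) by fastforce
    \<comment> \<open>Dividing \<open>b < a \<bullet> w\<close> by the negative number
      \<open>b\<close> gives the polar inequality, so the separating functional is a point of the
      polar to which \<open>low\<close> applies.\<close>
    have "a /\<^sub>R b \<in> P"
      using ab(2) b by (auto simp: P_def inner_commute field_simps less_imp_le)
    then have "(a /\<^sub>R b) \<bullet> y \<le> (1 + \<delta>) * p y" by (rule low[folded p_def])
    also have "\<dots> \<le> (1 + \<delta>) * 1"
      using y \<delta> by (intro mult_left_mono) (auto simp: gauge_body_def)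
    finally have "(a /\<^sub>R b) \<bullet> y \<le> 1 + \<delta>" by simp
    then have "b * (1 + \<delta>) \<le> a \<bullet> y"
      using b by (simp add: field_simps)
    then have "b \<le> (a \<bullet> y) / (1 + \<delta>)"
      using \<delta> by (simp add: pos_le_divide_eq)
    then show False using ab(1) by (simp add: divide_inverse_commute)
  qed
  ultimately show ?thesis by blast
qed

lemma NN_bodies_subset:
  assumes "\<phi> = gauge_param \<or> \<phi> = support_param"
  shows "NN_bodies \<phi> \<subseteq> convex_bodies0"
proof
  fix \<Omega> assume "\<Omega> \<in> NN_bodies \<phi>"
  then obtain m \<beta> W where \<Omega>: "\<Omega> = \<phi> (sublinear_net m \<beta> W) ` cball 0 1"
    and net: "1 \<le> m" "0 < \<beta>" "\<And>x. x \<noteq> 0 \<Longrightarrow> 0 < sublinear_net m \<beta> W x"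
    by (auto simp: NN_bodies_def)
  interpret positive_sublinear "sublinear_net m \<beta> W"
    using net by (rule positive_sublinear_net)
  show "\<Omega> \<in> convex_bodies0"
    using assms gauge_body support_body gauge_param_image
      support_param_image[OF sublinear_net_GDERIV[OF net(1)]] \<Omega> by auto
qed

theorem theorem2p1:
  fixes \<phi> :: "(real ^ 'n \<Rightarrow> real) \<Rightarrow> real ^ 'n \<Rightarrow> real ^ 'n"
  assumes "\<phi> = gauge_param \<or> \<phi> = support_param"
  shows "NN_bodies \<phi> \<subseteq> convex_bodies0 \<and>
    (\<forall>K \<in> convex_bodies0. \<forall>\<epsilon> > 0. \<exists>\<Omega> \<in> NN_bodies \<phi>. hausdorff_dist K \<Omega> < \<epsilon>)"
proof (intro conjI ballI allI impI)
  show "NN_bodies \<phi> \<subseteq> convex_bodies0"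
    using assms by (rule NN_bodies_subset)
next
  fix K :: "(real ^ 'n) set" and \<epsilon> :: real
  assume "K \<in> convex_bodies0" and \<epsilon>: "0 < \<epsilon>"
  then have K: "compact K" "convex K" and int: "0 \<in> interior K"
    by (auto simp: convex_bodies0_def convex_body_def)
  obtain r where r: "0 < r" "cball 0 r \<subseteq> K"
    using int by (auto simp: mem_interior_cball)
  obtain R where R: "0 < R" "\<And>x. x \<in> K \<Longrightarrow> norm x \<le> R"
    using compact_imp_bounded[OF K(1)] by (auto simp: bounded_pos)
  \<comment> \<open>The factor 2 makes \<open>\<delta> * R\<close> equal to half of
    \<open>\<epsilon>\<close>, hence the final bound strict.\<close>
  define \<delta> where "\<delta> = \<epsilon> / (2 * R)"
  have \<delta>: "0 < \<delta>" "\<delta> * R < \<epsilon>"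
    using \<epsilon> R(1) by (auto simp: \<delta>_def field_simps)
  obtain \<Omega> where \<Omega>: "\<Omega> \<in> NN_bodies \<phi>" "\<forall>x\<in>K. x /\<^sub>R (1 + \<delta>) \<in> \<Omega>" "\<forall>x\<in>\<Omega>. x /\<^sub>R (1 + \<delta>) \<in> K"
    using assms gauge_param_approx[OF K r \<delta>(1)] support_param_approx[OF K r \<delta>(1)] by blast
  have "K \<noteq> {}" using int interior_subset by blast
  moreover from this \<Omega>(2) have "\<Omega> \<noteq> {}" by blast
  ultimately have "hausdorff_dist K \<Omega> \<le> \<delta> * R"
    using \<Omega> R(2) \<delta>(1) by (intro hausdorff_dist_le_scaling) auto
  then show "\<exists>\<Omega>\<in>NN_bodies \<phi>. hausdorff_dist K \<Omega> < \<epsilon>"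
    using \<Omega>(1) \<delta>(2) by (intro bexI[of _ \<Omega>]) auto
qed

end
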